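(* Let $\nu=4$ and let the synthesized quarter-hour profiles be $$P^q_{i,h,k}(c)=\nu\,\overline P^q_i(h)\,w^q_{i,h,k}(c),\qquad w^q_{i,h,k}(c)=\frac{1-c}{\nu}+c\,\widehat w^q_{i,h,k},$$ with $\widehat w^q_{i,h,k}$ the normalized template and $\overline P^q_i(h)\ge0$ the hourly mean target defined in the context. Then for every $c\in[0,1]$, every area $i$, hour $h$, and channel $q\in\{\mathrm{mot},\mathrm{av}\}$, $$P^q_{i,h,k}(c)\ge0\quad(k=0,\dots,\nu-1),\qquad \frac1\nu\sum_{k=0}^{\nu-1}P^q_{i,h,k}(c)=\overline P^q_i(h).$$ Consequently the synthesis changes only the intra-hour allocation and neither creates nor removes hourly energy, i.e. $\sum_{k=0}^{\nu-1}\Delta_{\mathrm{ID}}P^q_{i,h,k}(c)=\Delta_{\mathrm{DA}}\overline P^q_i(h)$, where $\Delta_{\mathrm{ID}}=\tfrac14$ h and $\Delta_{\mathrm{DA}}=1$ h.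
   Context: $i$ ranges over a finite set of control areas and $h$ over a finite set of day-ahead hours; each hour is divided into $\nu=4$ quarter-hour bins $\mathcal B_{h,k}=[\tau_0^{\mathrm{DA}}+h\Delta_{\mathrm{DA}}+k\Delta_{\mathrm{ID}},\ \tau_0^{\mathrm{DA}}+h\Delta_{\mathrm{DA}}+(k+1)\Delta_{\mathrm{ID}})$, $k=0,\dots,\nu-1$, with $\tau_0^{\mathrm{DA}}$ the start time of the day-ahead grid. The channels are $\mathrm{mot}$ (gross motoring power) and $\mathrm{av}$ (available regenerative power). Raw templates: for each of finitely many train runs $\varrho$ with electrical pantograph power $p^{\mathrm{el}}_\varrho(\vartheta)\in\mathbb R$ at time $\vartheta$ and track position $x_\varrho(\vartheta)$, put $\pi^{\mathrm{mot}}_\varrho=\max\{p^{\mathrm{el}}_\varrho,0\}$, $\pi^{\mathrm{av}}_\varrho=\max\{-p^{\mathrm{el}}_\varrho,0\}$, and $$\widetilde P^q_{i,h,k}=\frac1{\Delta_{\mathrm{ID}}}\sum_\varrho\int_{\mathcal B_{h,k}}\mathbf 1\{\chi(x_\varrho(\vartheta))=i\}\,\pi^q_\varrho(\vartheta)\,\mathrm d\vartheta,$$ where $\chi$ maps each track position to the control area supplying it and $\mathbf 1\{\cdot\}$ is the indicator. In particular each $\widetilde P^q_{i,h,k}$ is a nonnegative real number. Normalized template: $\widehat w^q_{i,h,k}=\widetilde P^q_{i,h,k}/\sum_{j=0}^{\nu-1}\widetilde P^q_{i,h,j}$ if $\sum_j\widetilde P^q_{i,h,j}>0$, and $\widehat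 w^q_{i,h,k}=1/\nu$ otherwise. $\overline P^q_i(h)\ge0$ is the given hourly mean power target of channel $q$ in area $i$ and hour $h$. *)

theory Defs
  imports "HOL-Analysis.Analysis"
begin

(* Times are real numbers measured in hours. *)

definition nu :: nat where
  "nu = 4"

definition Delta_DA :: real where
  "Delta_DA = 1"

definition Delta_ID :: real where
  "Delta_ID = 1 / 4"

definition bin :: "real \<Rightarrow> nat \<Rightarrow> nat \<Rightarrow> real set" where
  "bin \<tau>\<^sub>0 h k =
     {\<tau>\<^sub>0 + real h * Delta_DA + real k * Delta_ID ..<
      \<tau>\<^sub>0 + real h * Delta_DA + real (k + 1) * Delta_ID}"

datatype channel = Mot | Av

fun channel_power :: "channel \<Rightarrow> real \<Rightarrow> real" where
  "channel_power Mot p = max p 0"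
| "channel_power Av p = max (- p) 0"

(* R is the set of train runs; p_el r t and x r t are the electrical pantograph power and the
   track position of run r at time t; area_of sends a track position to the control area
   supplying it.
   The integral is the Lebesgue integral, which is 0 by convention for a non-integrable
   integrand. *)
definition raw_template ::
  "real \<Rightarrow> 'run set \<Rightarrow> ('run \<Rightarrow> real \<Rightarrow> real) \<Rightarrow> ('run \<Rightarrow> real \<Rightarrow> 'pos) \<Rightarrow> ('pos \<Rightarrow> 'area)
     \<Rightarrow> channel \<Rightarrow> 'area \<Rightarrow> nat \<Rightarrow> nat \<Rightarrow> real" where
  "raw_template \<tau>\<^sub>0 R p_el x area_of q i h k =
     1 / Delta_ID *
     (\<Sum>r\<in>R. (LINT t:bin \<tau>\<^sub>0 h k|lebesgue.
        of_bool (area_of (x r t) = i) * channel_power q (p_el r t)))"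

definition normalized_template ::
  "real \<Rightarrow> 'run set \<Rightarrow> ('run \<Rightarrow> real \<Rightarrow> real) \<Rightarrow> ('run \<Rightarrow> real \<Rightarrow> 'pos) \<Rightarrow> ('pos \<Rightarrow> 'area)
     \<Rightarrow> channel \<Rightarrow> 'area \<Rightarrow> nat \<Rightarrow> nat \<Rightarrow> real" where
  "normalized_template \<tau>\<^sub>0 R p_el x area_of q i h k =
     (if (\<Sum>j<nu. raw_template \<tau>\<^sub>0 R p_el x area_of q i h j) > 0
      then raw_template \<tau>\<^sub>0 R p_el x area_of q i h k / (\<Sum>j<nu. raw_template \<tau>\<^sub>0 R p_el x area_of q i h j)
      else 1 / real nu)"

definition synth_weight ::
  "real \<Rightarrow> 'run set \<Rightarrow> ('run \<Rightarrow> real \<Rightarrow> real) \<Rightarrow> ('run \<Rightarrow> real \<Rightarrow> 'pos) \<Rightarrow> ('pos \<Rightarrow> 'area)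
     \<Rightarrow> real \<Rightarrow> channel \<Rightarrow> 'area \<Rightarrow> nat \<Rightarrow> nat \<Rightarrow> real" where
  "synth_weight \<tau>\<^sub>0 R p_el x area_of c q i h k =
     (1 - c) / real nu + c * normalized_template \<tau>\<^sub>0 R p_el x area_of q i h k"

(* Pbar q i h is the hourly mean power target. *)
definition synth_profile ::
  "real \<Rightarrow> 'run set \<Rightarrow> ('run \<Rightarrow> real \<Rightarrow> real) \<Rightarrow> ('run \<Rightarrow> real \<Rightarrow> 'pos) \<Rightarrow> ('pos \<Rightarrow> 'area)
     \<Rightarrow> (channel \<Rightarrow> 'area \<Rightarrow> nat \<Rightarrow> real) \<Rightarrow> real \<Rightarrow> channel \<Rightarrow> 'area \<Rightarrow> nat \<Rightarrow> nat \<Rightarrow> real" where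
  "synth_profile \<tau>\<^sub>0 R p_el x area_of Pbar c q i h k =
     real nu * Pbar q i h * synth_weight \<tau>\<^sub>0 R p_el x area_of c q i h k"

end

theory Submission
  imports Defs
begin

text \<open>
  The normalized template of an hour is a probability vector on the quarter-hour bins: either it
  is the vector of nonnegative raw templates divided by its positive sum, or it is the uniform
  vector. For \<open>c \<in> [0, 1]\<close> the synthesis weights are a convex combination of the uniform vector
  and this template, hence again a probability vector. Spreading the hourly amount \<open>\<nu> * Pbar\<close>
  over the bins with such weights keeps every share nonnegative and the total unchanged
  (lemmas \<open>synth_weight_nonneg\<close> and \<open>sum_synth_weight\<close>). The mean and the energy identities are
  both this conservation of the total, because \<open>\<nu>\<close> bins of length \<open>Delta_ID\<close> fill one hour of
  length \<open>Delta_DA\<close>.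
\<close>

lemma channel_power_nonneg: "channel_power q p \<ge> 0"
  by (cases q) auto

text \<open>Every integrand is nonnegative, so its integral is nonnegative if it exists, and it is the
  default value 0 otherwise.\<close>

lemma raw_template_nonneg: "raw_template \<tau>\<^sub>0 R p_el x area_of q i h k \<ge> 0"
  unfolding raw_template_def set_lebesgue_integral_def Delta_ID_def
  by (intro mult_nonneg_nonneg sum_nonneg Bochner_Integration.integral_nonneg)
    (auto simp: channel_power_nonneg)

lemma normalized_template_nonneg: "normalized_template \<tau>\<^sub>0 R p_el x area_of q i h k \<ge> 0"
  unfolding normalized_template_def by (auto intro: divide_nonneg_pos raw_template_nonneg)

lemma sum_normalized_template: "(\<Sum>k<nu. normalized_template \<tau>\<^sub>0 R p_el x area_of q i h k) = 1"
proof (cases "(\<Sum>j<nu. raw_template \<tau>\<^sub>0 R p_el x area_of q i h j) > 0")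
  case True
  then show ?thesis
    by (simp add: normalized_template_def flip: sum_divide_distrib)
next
  case False
  then show ?thesis
    by (simp add: normalized_template_def nu_def)
qed

lemma synth_weight_nonneg:
  assumes "c \<in> {0..1}"
  shows "synth_weight \<tau>\<^sub>0 R p_el x area_of c q i h k \<ge> 0"
  using assms unfolding synth_weight_def by (auto intro!: add_nonneg_nonneg mult_nonneg_nonneg normalized_template_nonneg)

text \<open>The uniform vector and the template both have sum 1, and their coefficients \<open>1 - c\<close> and
  \<open>c\<close> add up to 1.\<close>

lemma sum_synth_weight: "(\<Sum>k<nu. synth_weight \<tau>\<^sub>0 R p_el x area_of c q i h k) = 1"
proof -
  have "(\<Sum>k<nu. synth_weight \<tau>\<^sub>0 R p_el x area_of c q i h k)
      = real nu * ((1 - c) / real nu)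
        + c * (\<Sum>k<nu. normalized_template \<tau>\<^sub>0 R p_el x area_of q i h k)"
    by (simp add: synth_weight_def sum.distrib sum_distrib_left)
  also have "\<dots> = 1"
    unfolding sum_normalized_template by (simp add: nu_def field_simps)
  finally show ?thesis .
qed

lemma sum_synth_profile:
  "(\<Sum>k<nu. synth_profile \<tau>\<^sub>0 R p_el x area_of Pbar c q i h k) = real nu * Pbar q i h"
  by (simp add: synth_profile_def sum_synth_weight flip: sum_distrib_left)

theorem theorem23:
  fixes I :: "'area set" and H :: "nat set" and R :: "'run set"
    and \<tau>\<^sub>0 :: real
    and p_el :: "'run \<Rightarrow> real \<Rightarrow> real"
    and x :: "'run \<Rightarrow> real \<Rightarrow> 'pos"
    and area_of :: "'pos \<Rightarrow> 'area"
    and Pbar :: "channel \<Rightarrow> 'area \<Rightarrow> nat \<Rightarrow> real"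
  assumes "finite I" and "finite H" and "finite R"
    and "\<And>y. area_of y \<in> I"
    and "\<And>q i h. i \<in> I \<Longrightarrow> h \<in> H \<Longrightarrow> Pbar q i h \<ge> 0"
  shows "\<forall>c\<in>{0..1}. \<forall>i\<in>I. \<forall>h\<in>H. \<forall>q.
      (\<forall>k<nu. synth_profile \<tau>\<^sub>0 R p_el x area_of Pbar c q i h k \<ge> 0)
    \<and> 1 / real nu * (\<Sum>k<nu. synth_profile \<tau>\<^sub>0 R p_el x area_of Pbar c q i h k) = Pbar q i h
    \<and> (\<Sum>k<nu. Delta_ID * synth_profile \<tau>\<^sub>0 R p_el x area_of Pbar c q i h k) = Delta_DA * Pbar q i h"
proof (intro ballI allI conjI impI)
  fix c :: real and i h q k
  assume "c \<in> {0..1}" "i \<in> I" "h \<in> H"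
  then show "synth_profile \<tau>\<^sub>0 R p_el x area_of Pbar c q i h k \<ge> 0"
    using assms(5) unfolding synth_profile_def
    by (intro mult_nonneg_nonneg synth_weight_nonneg) auto
next
  fix c :: real and i h q
  show "1 / real nu * (\<Sum>k<nu. synth_profile \<tau>\<^sub>0 R p_el x area_of Pbar c q i h k) = Pbar q i h"
    unfolding sum_synth_profile by (simp add: nu_def)
  show "(\<Sum>k<nu. Delta_ID * synth_profile \<tau>\<^sub>0 R p_el x area_of Pbar c q i h k) = Delta_DA * Pbar q i h"
    unfolding sum_distrib_left[symmetric] sum_synth_profile
    by (simp add: nu_def Delta_ID_def Delta_DA_def)
qed

end
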